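(* Let $\mathcal{H}$ be a Hilbert space and $T:\mathcal{H}\to\mathcal{H}$ a compact operator such that $T^{*}T$ has simple spectrum, i.e. $T^{*}T=\sum_{j=1}^{\infty}\lambda_j^{2}|u_j\rangle\langle u_j|$ with $(u_j)$ orthonormal, $\lambda_1^{2}>\lambda_2^{2}>\cdots>0$, and $\lambda_j^{2}\to0$ as $j\to\infty$. Let $S=\sqrt{T^{*}T}$, $Q_k=\sum_{j=1}^{k}|u_j\rangle\langle u_j|$, and $Q_k^{\perp}=I-Q_k$. Then the eigenvalues can be obtained inductively as follows: for every $k\ge1$, $$\lambda_{k+1}^{2}=\lim_{n\to\infty}\frac{\big\|(SQ_k^{\perp})^{n+1}x\big\|^{2}}{\big\|(SQ_k^{\perp})^{n}x\big\|^{2}}\qquad\text{for all }x\in\mathcal{H}\text{ with }\langle u_{k+1},x\rangle\ne0,$$ and $$|u_{k+1}\rangle\langle u_{k+1}|=\lim_{n\to\infty}\lambda_{k+1}^{-2n}\big(Q_k^{\perp}T^{*}TQ_k^{\perp}\big)^{n},$$ where the last limit is in the norm topology of $B(\mathcal{H})$.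
   Context: Inner products are conjugate linear in the first variable; $|u\rangle\langle v|$ denotes the rank-one operator $w\mapsto\langle v,w\rangle u$. $B(\mathcal{H})$ is the algebra of bounded operators on $\mathcal{H}$. *)

theory Defs
  imports "HOL-Analysis.Analysis"
begin

text \<open>
  The inner product is conjugate linear in the first and linear in the second argument.
  The real normed structure is the one underlying the complex Hilbert space.
\<close>

class complex_inner = real_normed_vector +
  fixes scaleC :: "complex \<Rightarrow> 'a \<Rightarrow> 'a" (infixr "*\<^sub>C" 75)
    and cinner :: "'a \<Rightarrow> 'a \<Rightarrow> complex"
  assumes scaleC_add_right: "a *\<^sub>C (x + y) = a *\<^sub>C x + a *\<^sub>C y"
    and scaleC_add_left: "(a + b) *\<^sub>C x = a *\<^sub>C x + b *\<^sub>C x"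
    and scaleC_scaleC: "a *\<^sub>C b *\<^sub>C x = (a * b) *\<^sub>C x"
    and scaleR_scaleC: "r *\<^sub>R x = complex_of_real r *\<^sub>C x"
    and cinner_commute: "cinner x y = cnj (cinner y x)"
    and cinner_add_right: "cinner x (y + z) = cinner x y + cinner x z"
    and cinner_scaleC_right: "cinner x (a *\<^sub>C y) = a * cinner x y"
    and cinner_self: "cinner x x = complex_of_real ((norm x)\<^sup>2)"

class complex_hilbert = complex_inner + complete_space
begin
subclass banach ..
end

lemma cinner_add_left: "cinner (x + y) z = cinner x z + cinner y (z::'a::complex_inner)"
  by (metis cinner_add_right cinner_commute complex_cnj_add)

lemma cinner_scaleC_left: "cinner (a *\<^sub>C x) y = cnj a * cinner x (y::'a::complex_inner)"
  by (metis cinner_scaleC_right cinner_commute complex_cnj_mult)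

lemma norm_scaleC: "norm (a *\<^sub>C x) = cmod a * norm (x::'a::complex_inner)"
proof -
  have "complex_of_real ((norm (a *\<^sub>C x))\<^sup>2) = (a * cnj a) * cinner x x"
    unfolding cinner_self[symmetric] by (simp add: cinner_scaleC_left cinner_scaleC_right)
  also have "\<dots> = complex_of_real ((cmod a * norm x)\<^sup>2)"
    by (simp add: cinner_self complex_norm_square[symmetric] power_mult_distrib)
  finally have "(norm (a *\<^sub>C x))\<^sup>2 = (cmod a * norm x)\<^sup>2"
    by (simp only: of_real_eq_iff)
  then show ?thesis by (simp add: power2_eq_iff_nonneg)
qed

lemma Re_cinner_le: "Re (cinner x y) \<le> norm x * norm (y::'a::complex_inner)"
proof -
  have "cinner (x + y) (x + y) = cinner x x + cinner y y + (cinner x y + cnj (cinner x y))"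
    using cinner_commute[of y x] by (simp add: cinner_add_left cinner_add_right)
  then have "Re (cinner (x + y) (x + y)) = (norm x)\<^sup>2 + (norm y)\<^sup>2 + 2 * Re (cinner x y)"
    by (simp add: cinner_self)
  then have "(norm (x + y))\<^sup>2 = (norm x)\<^sup>2 + (norm y)\<^sup>2 + 2 * Re (cinner x y)"
    by (simp only: cinner_self Re_complex_of_real)
  moreover have "(norm (x + y))\<^sup>2 \<le> (norm x + norm y)\<^sup>2"
    by (intro power_mono norm_triangle_ineq) auto
  ultimately show ?thesis by (simp add: power2_sum)
qed

lemma cinner_Cauchy_Schwarz: "cmod (cinner x y) \<le> norm x * norm (y::'a::complex_inner)"
proof (cases "cinner x y = 0")
  case False
  let ?z = "cinner x y"
  have "(cmod ?z)\<^sup>2 = Re (cinner x (cnj ?z *\<^sub>C y))"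
    unfolding cinner_scaleC_right cmod_power2 by (simp add: power2_eq_square)
  also have "\<dots> \<le> cmod ?z * (norm x * norm y)"
    using Re_cinner_le[of x "cnj ?z *\<^sub>C y"] by (simp add: norm_scaleC ac_simps)
  finally show ?thesis using False by (simp add: power2_eq_square)
qed simp

text \<open>
  \<open>'a \<Rightarrow>\<^sub>L 'a\<close> consists of the bounded real-linear maps with the operator norm.  The algebra
  \<open>B(H)\<close> is its subspace of complex-linear maps, singled out by the following predicate; norm
  and topology of \<open>B(H)\<close> are the restricted ones.
\<close>

definition clinear_op :: "('a::complex_inner \<Rightarrow>\<^sub>L 'a) \<Rightarrow> bool" where
  "clinear_op A \<longleftrightarrow> (\<forall>c x. A (c *\<^sub>C x) = c *\<^sub>C A x)"

definition compact_op :: "('a::complex_inner \<Rightarrow>\<^sub>L 'a) \<Rightarrow> bool" where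
  "compact_op A \<longleftrightarrow> clinear_op A \<and> (\<forall>B. bounded B \<longrightarrow> compact (closure (blinfun_apply A ` B)))"

definition adj_op :: "('a::complex_inner \<Rightarrow>\<^sub>L 'a) \<Rightarrow> ('a \<Rightarrow>\<^sub>L 'a)" where
  "adj_op A = (THE B :: 'a \<Rightarrow>\<^sub>L 'a. \<forall>x y. cinner (B x) y = cinner x (A y))"

definition positive_op :: "('a::complex_inner \<Rightarrow>\<^sub>L 'a) \<Rightarrow> bool" where
  "positive_op A \<longleftrightarrow> clinear_op A \<and> (\<forall>x. cinner x (A x) \<in> \<real>\<^sub>\<ge>\<^sub>0)"

definition sqrt_op :: "('a::complex_inner \<Rightarrow>\<^sub>L 'a) \<Rightarrow> ('a \<Rightarrow>\<^sub>L 'a)" where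
  "sqrt_op A = (THE B. positive_op B \<and> B o\<^sub>L B = A)"

primrec op_power :: "('a::complex_inner \<Rightarrow>\<^sub>L 'a) \<Rightarrow> nat \<Rightarrow> ('a \<Rightarrow>\<^sub>L 'a)" where
  "op_power A 0 = id_blinfun"
| "op_power A (Suc n) = A o\<^sub>L op_power A n"

lift_definition rank_one :: "'a::complex_inner \<Rightarrow> 'a \<Rightarrow> ('a \<Rightarrow>\<^sub>L 'a)"
  is "\<lambda>u v w. cinner v w *\<^sub>C u"
proof (rule bounded_linear_intro)
  fix u v x y :: 'a and r :: real
  show "cinner v (x + y) *\<^sub>C u = cinner v x *\<^sub>C u + cinner v y *\<^sub>C u"
    by (simp add: cinner_add_right scaleC_add_left)
  show "cinner v (r *\<^sub>R x) *\<^sub>C u = r *\<^sub>R (cinner v x *\<^sub>C u)"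
    by (simp add: scaleR_scaleC cinner_scaleC_right scaleC_scaleC)
  show "norm (cinner v x *\<^sub>C u) \<le> norm x * (norm v * norm u)"
    using mult_right_mono[OF cinner_Cauchy_Schwarz[of v x] norm_ge_zero[of u]]
    by (simp add: norm_scaleC ac_simps)
qed

end

theory Submission
  imports Defs
begin

text \<open>
  For an orthonormal sequence \<open>u\<close> and a real null sequence \<open>c\<close>, the diagonal operator
  \<open>D c = (\<Sum>j. c j |u j\<rangle>\<langle>u j|)\<close> converges in operator norm, because Pythagoras and Bessel bound the
  norm of a finite diagonal sum by the largest modulus of its coefficients.  The map \<open>c \<mapsto> D c\<close> is
  linear and multiplicative (lemma \<open>diag_mult\<close>), so everything reduces to computing with
  coefficient sequences.

  The spectral hypothesis says that \<open>T\<^sup>* T\<close> is \<open>D (\<lambda>\<^sup>2)\<close>.  Its positive square root is \<open>D \<bar>\<lambda>\<bar>\<close>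
  (lemma \<open>sqrt_op_diag\<close>): a positive root \<open>B\<close> has to act on \<open>u j\<close> as the number \<open>\<bar>\<lambda> j\<bar>\<close>, since
  \<open>B + \<bar>\<lambda> j\<bar>\<close> is injective, and it has to vanish on the orthogonal complement of all \<open>u j\<close>.
  Multiplication by \<open>Q\<^sub>k\<^sup>\<bottom>\<close> deletes the first \<open>k\<close> coefficients.  Hence \<open>S Q\<^sub>k\<^sup>\<bottom>\<close> and
  \<open>Q\<^sub>k\<^sup>\<bottom> T\<^sup>* T Q\<^sub>k\<^sup>\<bottom>\<close> are both diagonal operators with a single coefficient, at \<open>u (k+1)\<close>, that exceeds
  all others by a fixed factor.

  Both limits are therefore instances of the power iteration (lemma \<open>power_iteration\<close>): if \<open>c m\<close>
  dominates in this way, \<open>(D c)\<^sup>n\<close> divided by \<open>(c m)\<^sup>n\<close> has coefficient \<open>1\<close> at \<open>m\<close> and coefficients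
  of size at most \<open>r\<^sup>n\<close> with \<open>r < 1\<close> elsewhere, so that it tends in norm to the projection onto
  \<open>u m\<close>.  Applied to a vector \<open>x\<close> with nonzero component along \<open>u m\<close>, this gives the limit of the
  quotients of norms.
\<close>

section \<open>The complex inner product\<close>

lemma bounded_linear_cinner_right: "bounded_linear (cinner (x::'a::complex_inner))"
proof (rule bounded_linear_intro)
  fix y z :: 'a and r :: real
  show "cinner x (y + z) = cinner x y + cinner x z"
    by (rule cinner_add_right)
  show "cinner x (r *\<^sub>R y) = r *\<^sub>R cinner x y"
    by (simp add: scaleR_scaleC cinner_scaleC_right scaleR_conv_of_real)
  show "norm (cinner x y) \<le> norm y * norm x"
    using cinner_Cauchy_Schwarz[of x y] by (simp add: mult.commute)
qed

lemmas cinner_zero_right [simp] = linear_0[OF bounded_linear.linear[OF bounded_linear_cinner_right]]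
  and cinner_diff_right = linear_diff[OF bounded_linear.linear[OF bounded_linear_cinner_right]]
  and cinner_scaleR_right = linear_scale[OF bounded_linear.linear[OF bounded_linear_cinner_right]]
  and cinner_sum_right = linear_sum[OF bounded_linear.linear[OF bounded_linear_cinner_right]]
  and cinner_sums_right = bounded_linear.sums[OF bounded_linear_cinner_right]

lemma cinner_diff_left: "cinner (x - y) z = cinner x z - cinner y (z::'a::complex_inner)"
  by (metis cinner_diff_right cinner_commute complex_cnj_diff)

lemma scaleC_zero_left [simp]: "0 *\<^sub>C (x::'a::complex_inner) = 0"
  using scaleR_scaleC[of 0 x] by simp

lemma scaleR_eq_scaleC_commute: "r *\<^sub>R (a *\<^sub>C x) = a *\<^sub>C (r *\<^sub>R (x::'a::complex_inner))"
  by (simp add: scaleR_scaleC scaleC_scaleC mult.commute)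

lemma bounded_linear_scaleC_right: "bounded_linear ((*\<^sub>C) a :: 'a::complex_inner \<Rightarrow> 'a)"
  by (rule bounded_linear_intro[where K = "cmod a"])
    (simp_all add: scaleC_add_right scaleR_eq_scaleC_commute norm_scaleC mult.commute)

lemma blinfun_compose_id [simp]: "A o\<^sub>L id_blinfun = A" "id_blinfun o\<^sub>L A = A"
  by (auto intro: blinfun_eqI)

section \<open>Positive operators and their square roots\<close>

text \<open>
  Polarization: the form \<open>\<langle>x, B y\<rangle> - \<langle>B x, y\<rangle>\<close> is sesquilinear and vanishes on the diagonal, where
  \<open>\<langle>x, B x\<rangle>\<close> is real.  Evaluating it at \<open>x + y\<close> and at \<open>x + \<i> y\<close> shows that it vanishes everywhere.
\<close>

lemma positive_op_selfadjoint:
  assumes B: "positive_op B"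
  shows "cinner x (B y) = cinner (B x) y"
proof -
  define h where "h x y = cinner x (B y) - cinner (B x) y" for x y
  have scale: "B (c *\<^sub>C x) = c *\<^sub>C B x" for c x
    using B by (simp add: positive_op_def clinear_op_def)
  have diag: "h x x = 0" for x
  proof -
    have "cinner x (B x) \<in> \<real>"
      using B nonneg_Reals_subset_Reals by (auto simp: positive_op_def)
    then have "cinner (B x) x = cinner x (B x)"
      by (metis cinner_commute Reals_cnj_iff)
    then show ?thesis by (simp add: h_def)
  qed
  have "h (x + y) (x + y) = h x x + h x y + h y x + h y y"
    by (simp add: h_def blinfun.add_right cinner_add_left cinner_add_right)
  then have sum: "h x y + h y x = 0" by (simp add: diag)
  have "h (x + \<i> *\<^sub>C y) (x + \<i> *\<^sub>C y) = h x x + \<i> * h x y - \<i> * h y x + h y y"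
    by (simp add: h_def blinfun.add_right cinner_add_left cinner_add_right scale
        cinner_scaleC_left cinner_scaleC_right algebra_simps)
  then have "\<i> * (h x y - h y x) = 0" by (simp add: diag algebra_simps)
  with sum have "h x y = 0" by simp
  then show ?thesis by (simp add: h_def)
qed

lemma selfadjoint_square_eq_zero:
  assumes "\<And>x y. cinner x (A y) = cinner (A x) y" and "A (A x) = 0"
  shows "A x = (0::'a::complex_inner)"
  using assms(1)[of x "A x"] assms(2) by (simp add: cinner_self)

text \<open>
  The square \<open>s\<^sup>2 - B\<^sup>2\<close> factors as \<open>(s + B) (s - B)\<close>, and \<open>s + B\<close> is injective for positive \<open>B\<close> and
  \<open>s > 0\<close>.
\<close>

lemma positive_op_eigenvector_of_square:
  assumes B: "positive_op B" and s: "s > 0" and square: "B (B v) = s\<^sup>2 *\<^sub>R v"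
  shows "B v = s *\<^sub>R v"
proof -
  define w where "w = B v - s *\<^sub>R v"
  have "B w = - (s *\<^sub>R w)"
    by (simp add: w_def blinfun.diff_right blinfun.scaleR_right square power2_eq_square
        scaleR_diff_right)
  then have "cinner w (B w) = - (s *\<^sub>R cinner w w)"
    using cinner_scaleR_right[of w "- s" w] by simp
  moreover have "0 \<le> Re (cinner w (B w))"
    using B by (auto simp: positive_op_def complex_nonneg_Reals_iff)
  ultimately have "s * (norm w)\<^sup>2 \<le> 0" by (simp add: cinner_self)
  with s have "w = 0" by (simp add: mult_le_0_iff)
  then show ?thesis by (simp add: w_def)
qed

section \<open>Diagonal operators\<close>

locale orthonormal_sequence =
  fixes u :: "nat \<Rightarrow> 'a::complex_hilbert"
  assumes orthonormal: "cinner (u i) (u j) = (if i = j then 1 else 0)"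
begin

abbreviation proj :: "nat \<Rightarrow> 'a \<Rightarrow>\<^sub>L 'a" where
  "proj j \<equiv> rank_one (u j) (u j)"

definition diag :: "(nat \<Rightarrow> real) \<Rightarrow> ('a \<Rightarrow>\<^sub>L 'a)" where
  "diag c = (\<Sum>j. c j *\<^sub>R proj j)"

lemma proj_apply: "proj j x = cinner (u j) x *\<^sub>C u j"
  by (simp add: rank_one.rep_eq)

lemma proj_mult: "proj i o\<^sub>L proj j = (if i = j then proj j else 0)"
  by (rule blinfun_eqI) (simp add: proj_apply cinner_scaleC_right orthonormal)

lemma cinner_finite_expansion:
  assumes "finite F"
  shows "cinner (u i) (\<Sum>j\<in>F. a j *\<^sub>C u j) = (if i \<in> F then a i else 0)"
  using assms by (simp add: cinner_sum_right cinner_scaleC_right orthonormal if_distrib cong: if_cong)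

lemma pythagoras:
  assumes "finite F"
  shows "(norm (\<Sum>j\<in>F. a j *\<^sub>C u j))\<^sup>2 = (\<Sum>j\<in>F. (cmod (a j))\<^sup>2)"
proof -
  let ?y = "\<Sum>j\<in>F. a j *\<^sub>C u j"
  have "cinner ?y ?y = (\<Sum>j\<in>F. a j * cinner ?y (u j))"
    by (simp add: cinner_sum_right cinner_scaleC_right)
  also have "\<dots> = (\<Sum>j\<in>F. a j * cnj (a j))"
  proof (rule sum.cong)
    fix j assume "j \<in> F"
    then have "cinner ?y (u j) = cnj (a j)"
      using assms cinner_commute[of ?y "u j"] by (simp add: cinner_finite_expansion)
    then show "a j * cinner ?y (u j) = a j * cnj (a j)" by simp
  qed simp
  also have "\<dots> = complex_of_real (\<Sum>j\<in>F. (cmod (a j))\<^sup>2)"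
    by (simp only: complex_norm_square of_real_sum)
  finally show ?thesis by (simp only: cinner_self of_real_eq_iff)
qed

text \<open>
  The partial expansion \<open>y\<close> of \<open>x\<close> satisfies \<open>\<langle>x, y\<rangle> = \<parallel>y\<parallel>\<^sup>2\<close>, so Cauchy--Schwarz gives
  \<open>\<parallel>y\<parallel> \<le> \<parallel>x\<parallel>\<close>.
\<close>

lemma bessel:
  assumes "finite F"
  shows "(\<Sum>j\<in>F. (cmod (cinner (u j) x))\<^sup>2) \<le> (norm x)\<^sup>2"
proof -
  let ?y = "\<Sum>j\<in>F. cinner (u j) x *\<^sub>C u j"
  have "cinner x ?y = (\<Sum>j\<in>F. cinner (u j) x * cnj (cinner (u j) x))"
    using cinner_commute[of x] by (simp add: cinner_sum_right cinner_scaleC_right)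
  also have "\<dots> = complex_of_real (\<Sum>j\<in>F. (cmod (cinner (u j) x))\<^sup>2)"
    by (simp only: complex_norm_square of_real_sum)
  also have "\<dots> = complex_of_real ((norm ?y)\<^sup>2)"
    by (simp only: pythagoras[OF assms])
  finally have "Re (cinner x ?y) = (norm ?y)\<^sup>2" by simp
  with Re_cinner_le[of x ?y] have "norm ?y * norm ?y \<le> norm x * norm ?y"
    by (simp add: power2_eq_square)
  then have "norm ?y \<le> norm x"
    by (cases "norm ?y = 0") (auto simp: mult_le_cancel_right)
  then have "(norm ?y)\<^sup>2 \<le> (norm x)\<^sup>2" by (intro power_mono) auto
  then show ?thesis by (simp only: pythagoras[OF assms])
qed

lemma norm_finite_diag_le:
  assumes F: "finite F" and C: "0 \<le> C" "\<And>j. j \<in> F \<Longrightarrow> \<bar>c j\<bar> \<le> C"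
  shows "norm (\<Sum>j\<in>F. c j *\<^sub>R proj j) \<le> C"
proof (rule norm_blinfun_bound[OF C(1)])
  fix x
  let ?a = "\<lambda>j. complex_of_real (c j) * cinner (u j) x"
  have "(\<Sum>j\<in>F. c j *\<^sub>R proj j) x = (\<Sum>j\<in>F. ?a j *\<^sub>C u j)"
    by (simp add: blinfun.sum_left blinfun.scaleR_left proj_apply scaleR_scaleC scaleC_scaleC)
  then have "(norm ((\<Sum>j\<in>F. c j *\<^sub>R proj j) x))\<^sup>2 = (\<Sum>j\<in>F. (c j)\<^sup>2 * (cmod (cinner (u j) x))\<^sup>2)"
    by (simp only: pythagoras[OF F]) (simp add: norm_mult power_mult_distrib)
  also have "\<dots> \<le> (\<Sum>j\<in>F. C\<^sup>2 * (cmod (cinner (u j) x))\<^sup>2)"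
  proof (intro sum_mono mult_right_mono)
    fix j assume "j \<in> F"
    then show "(c j)\<^sup>2 \<le> C\<^sup>2" using C by (intro abs_le_square_iff[THEN iffD1]) force
  qed simp
  also have "\<dots> \<le> C\<^sup>2 * (norm x)\<^sup>2"
    using bessel[OF F, of x] by (simp add: sum_distrib_left[symmetric] mult_left_mono)
  finally have "(norm ((\<Sum>j\<in>F. c j *\<^sub>R proj j) x))\<^sup>2 \<le> (C * norm x)\<^sup>2"
    by (simp add: power_mult_distrib)
  then show "norm ((\<Sum>j\<in>F. c j *\<^sub>R proj j) x) \<le> C * norm x"
    by (rule power2_le_imp_le) (simp add: C(1))
qed

text \<open>
  The Cauchy criterion holds because the norm of a block of the series is bounded by the largest
  modulus of its coefficients, not merely by the sum of the moduli.
\<close>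

lemma diag_sums:
  assumes "c \<longlonglongrightarrow> 0"
  shows "(\<lambda>j. c j *\<^sub>R proj j) sums diag c"
proof -
  have "summable (\<lambda>j. c j *\<^sub>R proj j)"
    unfolding summable_Cauchy
  proof (intro allI impI)
    fix e :: real assume e: "e > 0"
    then obtain N where N: "\<And>j. j \<ge> N \<Longrightarrow> \<bar>c j\<bar> < e / 2"
      using LIMSEQ_D[OF assms, of "e / 2"] by auto
    have "norm (\<Sum>j\<in>{m..<n}. c j *\<^sub>R proj j) \<le> e / 2" if "m \<ge> N" for m n
      using e N that by (intro norm_finite_diag_le) (auto intro: less_imp_le)
    then have "norm (\<Sum>j\<in>{m..<n}. c j *\<^sub>R proj j) < e" if "m \<ge> N" for m n
      using that e by (smt (verit) field_sum_of_halves)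
    then show "\<exists>N. \<forall>m\<ge>N. \<forall>n. norm (\<Sum>j\<in>{m..<n}. c j *\<^sub>R proj j) < e" by blast
  qed
  then show ?thesis by (simp add: diag_def summable_sums)
qed

lemma diag_eqI: "(\<lambda>j. c j *\<^sub>R proj j) sums A \<Longrightarrow> diag c = A"
  by (simp add: diag_def sums_iff)

lemma norm_diag_le:
  assumes "c \<longlonglongrightarrow> 0" and C: "\<And>j. \<bar>c j\<bar> \<le> C"
  shows "norm (diag c) \<le> C"
proof (rule LIMSEQ_le_const2)
  show "(\<lambda>n. norm (\<Sum>j<n. c j *\<^sub>R proj j)) \<longlonglongrightarrow> norm (diag c)"
    using diag_sums[OF assms(1)] unfolding sums_def by (rule tendsto_norm)
  have "0 \<le> C" using C[of 0] by linarith
  then show "\<exists>N. \<forall>n\<ge>N. norm (\<Sum>j<n. c j *\<^sub>R proj j) \<le> C"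
    using C by (intro exI allI impI norm_finite_diag_le) auto
qed

lemma diag_apply_sums:
  assumes "c \<longlonglongrightarrow> 0"
  shows "(\<lambda>j. (complex_of_real (c j) * cinner (u j) x) *\<^sub>C u j) sums diag c x"
  using bounded_linear.sums[OF blinfun.bounded_linear_left diag_sums[OF assms], of x]
  by (simp add: blinfun.scaleR_left proj_apply scaleR_scaleC scaleC_scaleC)

lemma proj_diag:
  assumes "c \<longlonglongrightarrow> 0"
  shows "proj i o\<^sub>L diag c = c i *\<^sub>R proj i"
proof -
  have "(\<lambda>j. proj i o\<^sub>L (c j *\<^sub>R proj j)) sums (proj i o\<^sub>L diag c)"
    by (rule bounded_linear.sums[OF bounded_bilinear.bounded_linear_right
          [OF bounded_bilinear_blinfun_compose] diag_sums[OF assms]])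
  moreover have "proj i o\<^sub>L (c j *\<^sub>R proj j) = (if j = i then c j *\<^sub>R proj j else 0)" for j
    by (simp add: bounded_bilinear.scaleR_right[OF bounded_bilinear_blinfun_compose] proj_mult)
  ultimately show ?thesis
    using sums_single[of i "\<lambda>j. c j *\<^sub>R proj j"] by (simp add: sums_unique2)
qed

lemma diag_mult:
  assumes "c \<longlonglongrightarrow> 0" "d \<longlonglongrightarrow> 0"
  shows "diag c o\<^sub>L diag d = diag (\<lambda>j. c j * d j)"
proof -
  have "(\<lambda>j. (c j *\<^sub>R proj j) o\<^sub>L diag d) sums (diag c o\<^sub>L diag d)"
    by (rule bounded_linear.sums[OF bounded_bilinear.bounded_linear_left
          [OF bounded_bilinear_blinfun_compose] diag_sums[OF assms(1)]])
  then show ?thesis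
    by (simp add: bounded_bilinear.scaleR_left[OF bounded_bilinear_blinfun_compose]
        proj_diag[OF assms(2)] diag_eqI)
qed

lemma diag_single: "diag (\<lambda>j. if j = m then 1 else 0) = proj m"
proof (rule diag_eqI)
  show "(\<lambda>j. (if j = m then 1 else 0) *\<^sub>R proj j) sums proj m"
    using sums_single[of m "\<lambda>j. proj j"] by (simp add: if_distrib[of "\<lambda>r. r *\<^sub>R _"] cong: if_cong)
qed

lemma diag_scaleR:
  assumes "c \<longlonglongrightarrow> 0"
  shows "r *\<^sub>R diag c = diag (\<lambda>j. r * c j)"
  using sums_scaleR_right[OF diag_sums[OF assms], of r] by (simp add: diag_eqI)

lemma diag_diff:
  assumes "c \<longlonglongrightarrow> 0" "d \<longlonglongrightarrow> 0"
  shows "diag c - diag d = diag (\<lambda>j. c j - d j)"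
  using sums_diff[OF diag_sums[OF assms(1)] diag_sums[OF assms(2)]]
  by (simp add: scaleR_diff_left diag_eqI)

lemma tendsto_single: "(\<lambda>j::nat. if j = m then 1 else 0 :: real) \<longlonglongrightarrow> 0"
  by (rule tendsto_eventually) (auto intro!: eventually_sequentiallyI[of "Suc m"])

lemma diag_proj:
  assumes "c \<longlonglongrightarrow> 0"
  shows "diag c o\<^sub>L proj i = c i *\<^sub>R proj i"
proof -
  have "diag c o\<^sub>L proj i = diag (\<lambda>j. c j * (if j = i then 1 else 0))"
    by (simp only: diag_single[symmetric] diag_mult[OF assms tendsto_single])
  also have "\<dots> = diag (\<lambda>j. c i * (if j = i then 1 else 0))"
    by (rule arg_cong[of _ _ diag]) auto
  also have "\<dots> = c i *\<^sub>R proj i"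
    by (simp only: diag_scaleR[OF tendsto_single, symmetric] diag_single)
  finally show ?thesis .
qed

lemma diag_eigenvector:
  assumes "c \<longlonglongrightarrow> 0"
  shows "diag c (u i) = c i *\<^sub>R u i"
proof -
  have "diag c (proj i (u i)) = c i *\<^sub>R proj i (u i)"
    using arg_cong[OF diag_proj[OF assms, of i], of "\<lambda>A. blinfun_apply A (u i)"]
    by (simp add: blinfun.scaleR_left)
  moreover have "proj i (u i) = u i"
    using scaleR_scaleC[of 1 "u i"] by (simp add: proj_apply orthonormal)
  ultimately show ?thesis by simp
qed

lemma diag_orthogonal:
  assumes "c \<longlonglongrightarrow> 0" "\<And>j. cinner (u j) x = 0"
  shows "diag c x = 0"
  using diag_apply_sums[OF assms(1), of x] by (simp add: assms(2) sums_iff)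

lemma positive_op_diag:
  assumes c: "c \<longlonglongrightarrow> 0" and nonneg: "\<And>j. 0 \<le> c j"
  shows "positive_op (diag c)"
  unfolding positive_op_def clinear_op_def
proof (intro conjI allI)
  fix a x
  have "(\<lambda>j. a *\<^sub>C (complex_of_real (c j) * cinner (u j) x) *\<^sub>C u j) sums (a *\<^sub>C diag c x)"
    by (rule bounded_linear.sums[OF bounded_linear_scaleC_right diag_apply_sums[OF c]])
  moreover have "(\<lambda>j. a *\<^sub>C (complex_of_real (c j) * cinner (u j) x) *\<^sub>C u j) sums diag c (a *\<^sub>C x)"
    using diag_apply_sums[OF c, of "a *\<^sub>C x"]
    by (simp add: scaleC_scaleC cinner_scaleC_right ac_simps)
  ultimately show "diag c (a *\<^sub>C x) = a *\<^sub>C diag c x" by (simp add: sums_unique2)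
next
  fix x
  have "cinner x ((complex_of_real (c j) * cinner (u j) x) *\<^sub>C u j) = complex_of_real (c j * (cmod (cinner (u j) x))\<^sup>2)"
    for j
    using cinner_commute[of x "u j"]
    by (simp add: cinner_scaleC_right complex_norm_square mult.assoc del: of_real_power)
  with cinner_sums_right[OF diag_apply_sums[OF c], of x x]
  have "(\<lambda>j. complex_of_real (c j * (cmod (cinner (u j) x))\<^sup>2)) sums cinner x (diag c x)"
    by simp
  then have "(\<lambda>n. \<Sum>j<n. complex_of_real (c j * (cmod (cinner (u j) x))\<^sup>2)) \<longlonglongrightarrow> cinner x (diag c x)"
    by (simp only: sums_def)
  moreover have "(\<Sum>j<n. complex_of_real (c j * (cmod (cinner (u j) x))\<^sup>2)) \<in> \<real>\<^sub>\<ge>\<^sub>0" for n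
    unfolding of_real_sum[symmetric] nonneg_Reals_of_real_iff
    using nonneg by (simp add: sum_nonneg)
  ultimately show "cinner x (diag c x) \<in> \<real>\<^sub>\<ge>\<^sub>0"
    by (rule closed_sequentially[OF closed_nonneg_Reals_complex, rotated])
qed

text \<open>
  For uniqueness, the difference of two positive roots is self-adjoint and kills every \<open>u j\<close>, so
  its range is orthogonal to all of them.  It also kills that orthogonal complement, hence its
  square is zero.
\<close>

lemma sqrt_op_diag:
  assumes d: "d \<longlonglongrightarrow> 0" and pos: "\<And>j. 0 < d j"
  shows "sqrt_op (diag d) = diag (\<lambda>j. sqrt (d j))"
proof -
  let ?R = "diag (\<lambda>j. sqrt (d j))"
  have sqrt_null: "(\<lambda>j. sqrt (d j)) \<longlonglongrightarrow> 0"
    using tendsto_real_sqrt[OF d] by simp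
  have R: "positive_op ?R"
    using pos by (intro positive_op_diag sqrt_null) (simp add: less_imp_le)
  have RR: "?R o\<^sub>L ?R = diag d"
    using pos by (simp add: diag_mult[OF sqrt_null sqrt_null] less_imp_le)
  show ?thesis unfolding sqrt_op_def
  proof (rule the_equality)
    fix B assume "positive_op B \<and> B o\<^sub>L B = diag d"
    then have B: "positive_op B" and BB: "B (B x) = diag d x" for x
      by (auto dest: arg_cong[of _ _ "\<lambda>A. blinfun_apply A x"])
    define C where "C = B - ?R"
    have C_apply: "C x = B x - ?R x" for x
      by (simp add: C_def blinfun.diff_left)
    have C_selfadjoint: "cinner x (C y) = cinner (C x) y" for x y
      by (simp add: C_apply cinner_diff_left cinner_diff_right
          positive_op_selfadjoint[OF B] positive_op_selfadjoint[OF R])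
    have "B (u j) = sqrt (d j) *\<^sub>R u j" for j
      by (rule positive_op_eigenvector_of_square[OF B])
        (use pos[of j] in \<open>simp_all add: BB diag_eigenvector[OF d]\<close>)
    then have C_u: "C (u j) = 0" for j
      by (simp add: C_apply diag_eigenvector[OF sqrt_null])
    have C_orthogonal: "C x = 0" if x: "\<And>j. cinner (u j) x = 0" for x
    proof -
      have "B x = 0"
        by (rule selfadjoint_square_eq_zero[of "blinfun_apply B"])
          (simp_all add: positive_op_selfadjoint[OF B] BB diag_orthogonal[OF d x])
      then show ?thesis by (simp add: C_apply diag_orthogonal[OF sqrt_null x])
    qed
    have "C x = 0" for x
    proof (rule selfadjoint_square_eq_zero[of "blinfun_apply C", OF C_selfadjoint])
      have "cinner (u j) (C x) = 0" for j
        using cinner_commute[of "C (u j)" x] by (simp add: C_selfadjoint C_u cinner_commute[of 0])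
      then show "C (C x) = 0" by (rule C_orthogonal)
    qed
    then show "B = ?R" by (intro blinfun_eqI) (simp add: C_apply)
  qed (simp add: R RR)
qed

section \<open>Deflation\<close>

definition deflate :: "nat \<Rightarrow> (nat \<Rightarrow> real) \<Rightarrow> nat \<Rightarrow> real" where
  "deflate k c j = (if j < k then 0 else c j)"

lemma deflate_tendsto:
  assumes "c \<longlonglongrightarrow> 0"
  shows "deflate k c \<longlonglongrightarrow> 0"
  by (rule Lim_transform_eventually[OF assms])
    (auto simp: deflate_def intro!: eventually_sequentiallyI[of k])

lemma diag_deflate:
  assumes "c \<longlonglongrightarrow> 0"
  shows "diag c - (\<Sum>j<k. c j *\<^sub>R proj j) = diag (deflate k c)"
proof (rule diag_eqI[symmetric])
  have "(\<lambda>j. if j \<in> {..<k} then c j *\<^sub>R proj j else 0) sums (\<Sum>j<k. c j *\<^sub>R proj j)"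
    by (rule sums_If_finite_set) simp
  from sums_diff[OF diag_sums[OF assms] this]
  show "(\<lambda>j. deflate k c j *\<^sub>R proj j) sums (diag c - (\<Sum>j<k. c j *\<^sub>R proj j))"
    by (rule sums_cong[THEN iffD1, rotated]) (simp add: deflate_def)
qed

lemma diag_compose_complement:
  assumes "c \<longlonglongrightarrow> 0"
  shows "diag c o\<^sub>L (id_blinfun - (\<Sum>j<k. proj j)) = diag (deflate k c)"
  unfolding diag_deflate[OF assms, symmetric] diag_proj[OF assms, symmetric]
  by (simp add: bounded_bilinear.diff_right[OF bounded_bilinear_blinfun_compose]
      bounded_bilinear.sum_right[OF bounded_bilinear_blinfun_compose])

lemma complement_compose_diag:
  assumes "c \<longlonglongrightarrow> 0"
  shows "(id_blinfun - (\<Sum>j<k. proj j)) o\<^sub>L diag c = diag (deflate k c)"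
  unfolding diag_deflate[OF assms, symmetric] proj_diag[OF assms, symmetric]
  by (simp add: bounded_bilinear.diff_left[OF bounded_bilinear_blinfun_compose]
      bounded_bilinear.sum_left[OF bounded_bilinear_blinfun_compose])

text \<open>
  The strict drop from \<open>c k\<close> to \<open>c (k+1)\<close> provides the factor by which the first surviving
  coefficient exceeds all others.
\<close>

lemma deflate_dominant:
  assumes pos: "\<And>j. 0 < c j" and decr: "\<And>j. c (Suc j) < c j" and "j \<noteq> k"
  shows "\<bar>deflate k c j\<bar> \<le> c (Suc k) / c k * deflate k c k"
proof (cases "j < k")
  case False
  with \<open>j \<noteq> k\<close> have "Suc k \<le> j" by simp
  moreover have "decseq c" using decr by (simp add: decseq_Suc_iff less_imp_le)
  ultimately have "c j \<le> c (Suc k)" by (simp add: decseqD)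
  with False pos[of j] pos[of k] show ?thesis by (simp add: deflate_def)
qed (use pos in \<open>simp add: deflate_def less_imp_le\<close>)

section \<open>Power iteration\<close>

text \<open>The zeroth power is the identity, which is not of the form \<open>diag c\<close> for a null sequence.\<close>

lemma op_power_diag:
  assumes "c \<longlonglongrightarrow> 0"
  shows "op_power (diag c) (Suc n) = diag (\<lambda>j. c j ^ Suc n)"
proof (induction n)
  case (Suc n)
  have "(\<lambda>j. c j ^ Suc n) \<longlonglongrightarrow> 0"
    using tendsto_power[OF assms, of "Suc n"] by simp
  then show ?case
    using diag_mult[OF assms, of "\<lambda>j. c j ^ Suc n"] Suc.IH by simp
qed simp

theorem power_iteration:
  assumes c: "c \<longlonglongrightarrow> 0" and cm: "0 < c m" and r: "r < 1"
    and dominant: "\<And>j. j \<noteq> m \<Longrightarrow> \<bar>c j\<bar> \<le> r * c m"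
  shows "(\<lambda>n. inverse (c m) ^ n *\<^sub>R op_power (diag c) n) \<longlonglongrightarrow> proj m"
proof (rule LIMSEQ_imp_Suc, rule LIM_zero_cancel)
  have "0 \<le> r * c m" using dominant[of "Suc m"] by linarith
  then have r0: "0 \<le> r" using cm by (simp add: zero_le_mult_iff)
  let ?e = "\<lambda>n j. inverse (c m) ^ Suc n * c j ^ Suc n - (if j = m then 1 else 0)"
  have pow: "(\<lambda>j. c j ^ Suc n) \<longlonglongrightarrow> 0" for n
    using tendsto_power[OF c, of "Suc n"] by simp
  then have scaled: "(\<lambda>j. inverse (c m) ^ Suc n * c j ^ Suc n) \<longlonglongrightarrow> 0" for n
    by (intro tendsto_mult_right_zero)
  have e: "inverse (c m) ^ Suc n *\<^sub>R op_power (diag c) (Suc n) - proj m = diag (?e n)" for n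
    by (simp only: op_power_diag[OF c] diag_scaleR[OF pow] diag_single[symmetric]
        diag_diff[OF scaled tendsto_single])
  have bound: "norm (diag (?e n)) \<le> r ^ Suc n" for n
  proof (rule norm_diag_le)
    show "?e n \<longlonglongrightarrow> 0" using tendsto_diff[OF scaled tendsto_single] by simp
    fix j
    show "\<bar>?e n j\<bar> \<le> r ^ Suc n"
    proof (cases "j = m")
      case True
      then have "inverse (c m) ^ Suc n * c j ^ Suc n = 1"
        using cm by (simp only: power_mult_distrib[symmetric]) simp
      with True r0 show ?thesis by simp
    next
      case False
      then have "\<bar>?e n j\<bar> = (inverse (c m) * \<bar>c j\<bar>) ^ Suc n"
        using cm by (simp only: power_mult_distrib[symmetric] power_abs if_False diff_zero
            abs_mult abs_inverse abs_of_pos)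
      also have "\<dots> \<le> r ^ Suc n"
      proof (rule power_mono)
        show "inverse (c m) * \<bar>c j\<bar> \<le> r"
          using cm dominant[OF False] by (simp add: inverse_eq_divide pos_divide_le_eq)
        show "0 \<le> inverse (c m) * \<bar>c j\<bar>" using cm by simp
      qed
      finally show ?thesis .
    qed
  qed
  have "(\<lambda>n. r ^ Suc n) \<longlonglongrightarrow> 0"
    using LIMSEQ_realpow_zero[OF r0 r] by (rule LIMSEQ_Suc)
  then have "(\<lambda>n. diag (?e n)) \<longlonglongrightarrow> 0"
    by (rule Lim_null_comparison[OF always_eventually, OF allI, OF bound])
  then show "(\<lambda>n. inverse (c m) ^ Suc n *\<^sub>R op_power (diag c) (Suc n) - proj m) \<longlonglongrightarrow> 0"
    by (simp only: e)
qed

text \<open>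
  After rescaling by \<open>(c m)\<^sup>-\<^sup>n\<close>, numerator and denominator tend to the same nonzero number; the
  scaling contributes the factor \<open>(c m)\<^sup>2\<close>.
\<close>

corollary power_iteration_quotient:
  assumes c: "c \<longlonglongrightarrow> 0" and cm: "0 < c m" and r: "r < 1"
    and dominant: "\<And>j. j \<noteq> m \<Longrightarrow> \<bar>c j\<bar> \<le> r * c m"
    and x: "cinner (u m) x \<noteq> 0"
  shows "(\<lambda>n. (norm (op_power (diag c) (n + 1) x))\<^sup>2 / (norm (op_power (diag c) n x))\<^sup>2)
    \<longlonglongrightarrow> (c m)\<^sup>2"
proof -
  let ?y = "\<lambda>n. (inverse (c m) ^ n *\<^sub>R op_power (diag c) n) x"
  have "norm (u m) = 1"
    using cinner_self[of "u m"] by (simp add: orthonormal abs_square_eq_1 flip: of_real_power)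
  then have limit_nz: "norm (proj m x) \<noteq> 0"
    using x by (simp add: proj_apply norm_scaleC)
  have "?y \<longlonglongrightarrow> proj m x"
    by (intro blinfun.tendsto power_iteration[OF c cm r dominant] tendsto_const)
  then have y: "(\<lambda>n. (norm (?y n))\<^sup>2) \<longlonglongrightarrow> (norm (proj m x))\<^sup>2"
    by (intro tendsto_power tendsto_norm)
  have "(\<lambda>n. (c m)\<^sup>2 * ((norm (?y (Suc n)))\<^sup>2 / (norm (?y n))\<^sup>2))
      \<longlonglongrightarrow> (c m)\<^sup>2 * ((norm (proj m x))\<^sup>2 / (norm (proj m x))\<^sup>2)"
    using limit_nz by (intro tendsto_mult tendsto_const tendsto_divide y LIMSEQ_Suc[OF y]) simp
  moreover have "(c m)\<^sup>2 * ((norm (?y (Suc n)))\<^sup>2 / (norm (?y n))\<^sup>2)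
      = (norm (op_power (diag c) (n + 1) x))\<^sup>2 / (norm (op_power (diag c) n x))\<^sup>2" for n
    using cm by (simp add: blinfun.scaleR_left power_mult_distrib power_inverse field_simps
        del: op_power.simps)
  ultimately show ?thesis using limit_nz by simp
qed

end

section \<open>Recovering the eigenvalues and eigenprojections\<close>

theorem corollary2p20:
  fixes T S :: "'a::complex_hilbert \<Rightarrow>\<^sub>L 'a"
    and Q Qperp :: "nat \<Rightarrow> 'a \<Rightarrow>\<^sub>L 'a"
    and u :: "nat \<Rightarrow> 'a"
    and lam :: "nat \<Rightarrow> real"
  assumes compact: "compact_op T"
    and orthonormal: "\<And>i j. i \<ge> 1 \<Longrightarrow> j \<ge> 1 \<Longrightarrow> cinner (u i) (u j) = (if i = j then 1 else 0)"
    and pos: "\<And>j. j \<ge> 1 \<Longrightarrow> (lam j)\<^sup>2 > 0"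
    and decreasing: "\<And>j. j \<ge> 1 \<Longrightarrow> (lam (Suc j))\<^sup>2 < (lam j)\<^sup>2"
    and to_zero: "(\<lambda>j. (lam j)\<^sup>2) \<longlonglongrightarrow> 0"
    and spectral: "(\<lambda>j. (lam (Suc j))\<^sup>2 *\<^sub>R rank_one (u (Suc j)) (u (Suc j))) sums (adj_op T o\<^sub>L T)"
    and S: "S = sqrt_op (adj_op T o\<^sub>L T)"
    and Q: "\<And>k. Q k = (\<Sum>j = 1..k. rank_one (u j) (u j))"
    and Qperp: "\<And>k. Qperp k = id_blinfun - Q k"
  shows "\<forall>k\<ge>1.
    (\<forall>x. cinner (u (k + 1)) x \<noteq> 0 \<longrightarrow>
      (\<lambda>n. (norm (op_power (S o\<^sub>L Qperp k) (n + 1) x))\<^sup>2 / (norm (op_power (S o\<^sub>L Qperp k) n x))\<^sup>2)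
        \<longlonglongrightarrow> (lam (k + 1))\<^sup>2) \<and>
    (\<lambda>n. (lam (k + 1) powi (- 2 * int n)) *\<^sub>R op_power (Qperp k o\<^sub>L (adj_op T o\<^sub>L T) o\<^sub>L Qperp k) n)
        \<longlonglongrightarrow> rank_one (u (k + 1)) (u (k + 1))"
proof (intro allI impI)
  fix k :: nat
  assume "k \<ge> 1"
  \<comment> \<open>The diagonal calculus numbers its vectors from \<open>0\<close>.\<close>
  define v where "v j = u (Suc j)" for j
  define c where "c j = \<bar>lam (Suc j)\<bar>" for j
  define d where "d j = (lam (Suc j))\<^sup>2" for j
  interpret orthonormal_sequence v
    by unfold_locales (simp add: v_def orthonormal)
  have d: "d \<longlonglongrightarrow> 0" unfolding d_def using to_zero by (rule LIMSEQ_Suc)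
  have d_pos: "0 < d j" for j using pos[of "Suc j"] by (simp add: d_def)
  have d_decr: "d (Suc j) < d j" for j using decreasing[of "Suc j"] by (simp add: d_def)
  have c_sqrt: "c = (\<lambda>j. sqrt (d j))" by (simp add: fun_eq_iff c_def d_def)
  have c: "c \<longlonglongrightarrow> 0" using tendsto_real_sqrt[OF d] by (simp add: c_sqrt)
  have c_pos: "0 < c j" and c_decr: "c (Suc j) < c j" for j
    using d_pos d_decr by (simp_all add: c_sqrt)
  have TT: "adj_op T o\<^sub>L T = diag d"
    using spectral by (simp add: diag_eqI d_def v_def)
  have Sd: "S = diag c"
    by (simp add: S TT sqrt_op_diag[OF d d_pos] c_sqrt)
  have Qp: "Qperp k = id_blinfun - (\<Sum>j<k. proj j)"
    by (simp add: Qperp Q v_def sum.atLeast1_atMost_eq)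
  have SQ: "S o\<^sub>L Qperp k = diag (deflate k c)"
    by (simp add: Sd Qp diag_compose_complement[OF c])
  have "deflate k (deflate k d) = deflate k d"
    by (rule ext) (simp add: deflate_def)
  then have QTTQ: "Qperp k o\<^sub>L (adj_op T o\<^sub>L T) o\<^sub>L Qperp k = diag (deflate k d)"
    by (simp add: TT Qp complement_compose_diag[OF d]
        diag_compose_complement[OF deflate_tendsto[OF d]])
  have at_k: "deflate k c k = c k" "deflate k d k = d k" by (simp_all add: deflate_def)
  show "(\<forall>x. cinner (u (k + 1)) x \<noteq> 0 \<longrightarrow>
      (\<lambda>n. (norm (op_power (S o\<^sub>L Qperp k) (n + 1) x))\<^sup>2 / (norm (op_power (S o\<^sub>L Qperp k) n x))\<^sup>2)
        \<longlonglongrightarrow> (lam (k + 1))\<^sup>2) \<and>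
    (\<lambda>n. (lam (k + 1) powi (- 2 * int n)) *\<^sub>R op_power (Qperp k o\<^sub>L (adj_op T o\<^sub>L T) o\<^sub>L Qperp k) n)
        \<longlonglongrightarrow> rank_one (u (k + 1)) (u (k + 1))"
  proof (intro conjI allI impI)
    fix x assume "cinner (u (k + 1)) x \<noteq> 0"
    then have x: "cinner (v k) x \<noteq> 0" by (simp add: v_def)
    have "(\<lambda>n. (norm (op_power (S o\<^sub>L Qperp k) (n + 1) x))\<^sup>2 / (norm (op_power (S o\<^sub>L Qperp k) n x))\<^sup>2)
        \<longlonglongrightarrow> (deflate k c k)\<^sup>2"
      unfolding SQ
    proof (rule power_iteration_quotient[OF deflate_tendsto[OF c] _ _ _ x])
      show "0 < deflate k c k" "c (Suc k) / c k < 1"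
        using c_pos[of k] c_decr[of k] by (simp_all add: at_k)
    qed (rule deflate_dominant[of c, OF c_pos c_decr])
    then show "(\<lambda>n. (norm (op_power (S o\<^sub>L Qperp k) (n + 1) x))\<^sup>2 / (norm (op_power (S o\<^sub>L Qperp k) n x))\<^sup>2)
        \<longlonglongrightarrow> (lam (k + 1))\<^sup>2"
      by (simp add: at_k c_def del: op_power.simps)
  next
    have "lam (k + 1) powi (- 2 * int n) = inverse (deflate k d k) ^ n" for n
    proof -
      have "lam (k + 1) powi (- 2 * int n) = inverse (lam (k + 1) powi (int (2 * n)))"
        by (simp add: power_int_minus[symmetric])
      also have "\<dots> = inverse (deflate k d k) ^ n"
        unfolding power_int_of_nat at_k by (simp add: d_def power_mult power_inverse)
      finally show ?thesis .
    qed
    moreover have "(\<lambda>n. inverse (deflate k d k) ^ n *\<^sub>R op_power (diag (deflate k d)) n) \<longlonglongrightarrow> proj k"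
    proof (rule power_iteration[OF deflate_tendsto[OF d]])
      show "0 < deflate k d k" "d (Suc k) / d k < 1"
        using d_pos[of k] d_decr[of k] by (simp_all add: at_k)
    qed (rule deflate_dominant[of d, OF d_pos d_decr])
    ultimately show "(\<lambda>n. (lam (k + 1) powi (- 2 * int n)) *\<^sub>R
          op_power (Qperp k o\<^sub>L (adj_op T o\<^sub>L T) o\<^sub>L Qperp k) n)
        \<longlonglongrightarrow> rank_one (u (k + 1)) (u (k + 1))"
      by (simp add: QTTQ v_def)
  qed
qed

end
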